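(* Consider $\partial_t x = F_2 x^{\otimes 2}+F_1x+F_0$ with pivot $s$, let $Q$ be a positive definite matrix, $O=Q^\dagger Q$, $u(t)=x(t)-s$ and $v(t)=Qu(t)$. Suppose $F_{2,s}\neq0$, $\mu_O(F_{1,s})<0$ and $\mu_O(F_{1,s})^2-4\|F_{2,s}\|_O\|F_{0,s}\|_O>0$, and define $$r_\pm^O=\frac{-\mu_O(F_{1,s})\pm\sqrt{\mu_O(F_{1,s})^2-4\|F_{2,s}\|_O\|F_{0,s}\|_O}}{2\|F_{2,s}\|_O}.$$ Then for all $t\ge0$ in the interval of existence of the solution: if $\|u(0)\|_O=\|v(0)\|\in[r_-^O,r_+^O)$, then $\|u(t)\|_O=\|v(t)\|\le\|u(0)\|_O<r_+^O$; if $\|u(0)\|_O=\|v(0)\|\in[0,r_-^O)$, then $\|u(t)\|_O=\|v(t)\|<r_-^O$.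
   Context: Setting: $x(t)\in\mathbb{R}^n$, $F_2\in\mathbb{R}^{n\times n^2}$, $F_1\in\mathbb{R}^{n\times n}$, $F_0\in\mathbb{R}^n$, Kronecker product $\otimes$; $F_{2,s}=F_2$, $F_{1,s}=F_1+F_2(s\otimes I_n+I_n\otimes s)$, $F_{0,s}=F_2s^{\otimes2}+F_1s+F_0$. Norms: $\|\cdot\|$ Euclidean/operator norm; for $O\succ0$, $\|y\|_O=\sqrt{y^\dagger Oy}$ for vectors, $\|F\|_O=\|O^{1/2}FO^{-1/2}\|$ for $n\times n$ matrices, $\|G\|_O=\|O^{1/2}G(O^{-1/2}\otimes O^{-1/2})\|$ for $n\times n^2$ matrices; $\mu(F)=\frac12\lambda_{\max}(F+F^\dagger)$, $\mu_O(F)=\mu(O^{1/2}FO^{-1/2})$. *)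

theory Defs
  imports "HOL-Analysis.Analysis"
begin

text \<open>Real matrices are elements of type real^'c^'r (rows indexed by 'r).
  Vectors of R^(n^2) are indexed by the finite type 'n \<times> 'n (Kronecker index (i,j)).\<close>

definition pos_def :: "real^'n^'n \<Rightarrow> bool" where
  "pos_def A \<longleftrightarrow> transpose A = A \<and> (\<forall>x. x \<noteq> 0 \<longrightarrow> x \<bullet> (A *v x) > 0)"

text \<open>Positive definite square root Om^(1/2).\<close>
definition mat_sqrt :: "real^'n^'n \<Rightarrow> real^'n^'n" where
  "mat_sqrt Om = (THE S. pos_def S \<and> S ** S = Om)"

text \<open>Kronecker products.\<close>
definition vkron :: "real^'n \<Rightarrow> real^'m \<Rightarrow> real^('n \<times> 'm)" where
  "vkron x y = (\<chi> p. x $ fst p * y $ snd p)"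

definition mkron :: "real^'c1^'r1 \<Rightarrow> real^'c2^'r2 \<Rightarrow> real^('c1 \<times> 'c2)^('r1 \<times> 'r2)" where
  "mkron A B = (\<chi> p q. A $ fst p $ fst q * B $ snd p $ snd q)"

text \<open>s \<otimes> I_n and I_n \<otimes> s, with s a column vector (n^2 \<times> n matrices).\<close>
definition kron_vec_id :: "real^'n \<Rightarrow> real^'n^('n \<times> 'n)" where
  "kron_vec_id s = (\<chi> p k. s $ fst p * (mat 1 :: real^'n^'n) $ snd p $ k)"

definition kron_id_vec :: "real^'n \<Rightarrow> real^'n^('n \<times> 'n)" where
  "kron_id_vec s = (\<chi> p k. (mat 1 :: real^'n^'n) $ fst p $ k * s $ snd p)"

text \<open>Shifted coefficients.\<close>
definition F1s :: "real^('n \<times> 'n)^'n \<Rightarrow> real^'n^'n \<Rightarrow> real^'n \<Rightarrow> real^'n^'n" where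
  "F1s F2 F1 s = F1 + F2 ** (kron_vec_id s + kron_id_vec s)"

definition F0s :: "real^('n \<times> 'n)^'n \<Rightarrow> real^'n^'n \<Rightarrow> real^'n \<Rightarrow> real^'n \<Rightarrow> real^'n" where
  "F0s F2 F1 F0 s = F2 *v vkron s s + F1 *v s + F0"

text \<open>Largest eigenvalue and logarithmic norm mu(F) = 1/2 lambda_max(F + F^T).\<close>
definition lambda_max :: "real^'n^'n \<Rightarrow> real" where
  "lambda_max A = Max {l. \<exists>v. v \<noteq> 0 \<and> A *v v = l *\<^sub>R v}"

definition mu :: "real^'n^'n \<Rightarrow> real" where
  "mu F = lambda_max (F + transpose F) / 2"

definition muO :: "real^'n^'n \<Rightarrow> real^'n^'n \<Rightarrow> real" where
  "muO Om F = mu (mat_sqrt Om ** F ** matrix_inv (mat_sqrt Om))"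

text \<open>Weighted norms.\<close>
definition vnormO :: "real^'n^'n \<Rightarrow> real^'n \<Rightarrow> real" where
  "vnormO Om y = sqrt (y \<bullet> (Om *v y))"

definition mnormO :: "real^'n^'n \<Rightarrow> real^'n^'n \<Rightarrow> real" where
  "mnormO Om F = onorm (\<lambda>y. (mat_sqrt Om ** F ** matrix_inv (mat_sqrt Om)) *v y)"

definition tnormO :: "real^'n^'n \<Rightarrow> real^('n \<times> 'n)^'n \<Rightarrow> real" where
  "tnormO Om G = onorm (\<lambda>y. (mat_sqrt Om ** G **
      mkron (matrix_inv (mat_sqrt Om)) (matrix_inv (mat_sqrt Om))) *v y)"

end

theory Submission
  imports Defs
begin

text \<open>Write \<open>a = \<parallel>F\<^sub>2\<^sub>,\<^sub>s\<parallel>\<^sub>O\<close>, \<open>m = \<mu>\<^sub>O(F\<^sub>1\<^sub>,\<^sub>s)\<close>, \<open>c = \<parallel>F\<^sub>0\<^sub>,\<^sub>s\<parallel>\<^sub>O\<close>.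
  Since \<open>Q\<close> is the unique positive definite square root of \<open>O\<close>, the vector \<open>v = Q u\<close>
  satisfies \<open>v' = G (v \<otimes> v) + A v + w\<close> with \<open>G = Q F\<^sub>2\<^sub>,\<^sub>s (Q\<^sup>-\<^sup>1 \<otimes> Q\<^sup>-\<^sup>1)\<close>,
  \<open>A = Q F\<^sub>1\<^sub>,\<^sub>s Q\<^sup>-\<^sup>1\<close> and \<open>w = Q F\<^sub>0\<^sub>,\<^sub>s\<close>, whose Euclidean operator norm, logarithmic norm
  and norm are exactly \<open>a\<close>, \<open>m\<close> and \<open>c\<close>. Cauchy-Schwarz and the Rayleigh bound
  \<open>v \<bullet> A v \<le> \<mu>(A) \<parallel>v\<parallel>\<^sup>2\<close> then give
  \<open>d/dt \<parallel>v\<parallel>\<^sup>2 \<le> 2 \<parallel>v\<parallel> (a \<parallel>v\<parallel>\<^sup>2 + m \<parallel>v\<parallel> + c) = 2 a \<parallel>v\<parallel> (\<parallel>v\<parallel> - r\<^sub>-) (\<parallel>v\<parallel> - r\<^sub>+)\<close>.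
  Between the roots the right-hand side is negative, so \<open>\<parallel>v\<parallel>\<close> never exceeds its initial
  value. Below \<open>r\<^sub>-\<close> it is at most \<open>2 a r\<^sub>+ (r\<^sub>-\<^sup>2 - \<parallel>v\<parallel>\<^sup>2)\<close>, so
  \<open>(\<parallel>v\<parallel>\<^sup>2 - r\<^sub>-\<^sup>2) exp (2 a r\<^sub>+ t)\<close> cannot increase while negative and \<open>\<parallel>v\<parallel>\<close> stays below \<open>r\<^sub>-\<close>.\<close>

section \<open>Symmetric matrices\<close>

lemma symmetric_inner_mult:
  fixes B :: "real^'n^'n"
  assumes "transpose B = B"
  shows "x \<bullet> (B *v y) = (B *v x) \<bullet> y"
  by (metis assms dot_lmul_matrix vector_transpose_matrix)

lemma eq_0_if_nonneg_quadratic: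
  fixes a b :: real
  assumes nonneg: "\<And>e. 0 \<le> 2 * e * a + e\<^sup>2 * b"
  shows "a = 0"
proof (rule ccontr)
  assume "a \<noteq> 0"
  define k where "k = \<bar>b\<bar> + 1"
  have "k > 0" "b < k"
    by (auto simp: k_def)
  hence "b / k - 2 < 0"
    by (simp add: divide_less_eq)
  have "2 * (- a / k) * a + (- a / k)\<^sup>2 * b = a\<^sup>2 / k * (b / k - 2)"
    using \<open>k > 0\<close> by (simp add: field_simps power2_eq_square)
  also have "\<dots> < 0"
    using \<open>a \<noteq> 0\<close> \<open>k > 0\<close> \<open>b / k - 2 < 0\<close> by (intro mult_pos_neg) auto
  finally show False
    using nonneg[of "- a / k"] by simp
qed

lemma eigenvector_if_rayleigh_bound_attained:
  fixes B :: "real^'n^'n"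
  assumes sym: "transpose B = B"
    and le: "\<And>w. w \<bullet> (B *v w) \<le> M * (w \<bullet> w)"
    and eq: "v \<bullet> (B *v v) = M * (v \<bullet> v)"
  shows "B *v v = M *\<^sub>R v"
proof -
  define r where "r = M *\<^sub>R v - B *v v"
  have "0 \<le> 2 * e * (r \<bullet> r) + e\<^sup>2 * (M * (r \<bullet> r) - r \<bullet> (B *v r))" for e
  proof -
    have "v \<bullet> (B *v r) = r \<bullet> (B *v v)"
      using symmetric_inner_mult[OF sym] by (simp add: inner_commute)
    hence form: "(v + e *\<^sub>R r) \<bullet> (B *v (v + e *\<^sub>R r))
        = M * (v \<bullet> v) + 2 * e * (r \<bullet> (B *v v)) + e\<^sup>2 * (r \<bullet> (B *v r))"
      using eq by (simp add: matrix_vector_right_distrib matrix_vector_mult_scaleR inner_add_left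
          inner_add_right power2_eq_square algebra_simps)
    have sq: "(v + e *\<^sub>R r) \<bullet> (v + e *\<^sub>R r) = v \<bullet> v + 2 * e * (r \<bullet> v) + e\<^sup>2 * (r \<bullet> r)"
      by (simp add: inner_add_left inner_add_right power2_eq_square algebra_simps inner_commute)
    have "0 \<le> M * ((v + e *\<^sub>R r) \<bullet> (v + e *\<^sub>R r)) - (v + e *\<^sub>R r) \<bullet> (B *v (v + e *\<^sub>R r))"
      using le by simp
    also have "\<dots> = 2 * e * (M * (r \<bullet> v) - r \<bullet> (B *v v)) + e\<^sup>2 * (M * (r \<bullet> r) - r \<bullet> (B *v r))"
      unfolding form sq by (simp add: algebra_simps)
    also have "M * (r \<bullet> v) - r \<bullet> (B *v v) = r \<bullet> r"
      by (simp add: r_def inner_diff_right)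
    finally show ?thesis .
  qed
  hence "r \<bullet> r = 0"
    by (rule eq_0_if_nonneg_quadratic)
  thus ?thesis
    by (simp add: r_def)
qed

lemma symmetric_max_eigenvalue:
  fixes B :: "real^'n^'n"
  assumes sym: "transpose B = B"
  obtains M v where "v \<noteq> 0" "B *v v = M *\<^sub>R v" "\<And>w. w \<bullet> (B *v w) \<le> M * (w \<bullet> w)"
proof -
  define q where "q w = w \<bullet> (B *v w)" for w :: "real^'n"
  have "continuous_on (sphere 0 1) q"
    unfolding q_def by (intro continuous_intros linear_continuous_on matrix_vector_mul_bounded_linear)
  moreover have "sphere (0::real^'n) 1 \<noteq> {}"
    using vector_choose_size[of 1] by auto
  ultimately obtain v where v: "v \<in> sphere 0 1" and max: "\<And>w. w \<in> sphere 0 1 \<Longrightarrow> q w \<le> q v"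
    using continuous_attains_sup[OF compact_sphere] by blast
  have "v \<bullet> v = 1"
    using v by (simp add: dot_square_norm)
  have bound: "w \<bullet> (B *v w) \<le> q v * (w \<bullet> w)" for w
  proof (cases "w = 0")
    case False
    have "q ((1 / norm w) *\<^sub>R w) \<le> q v"
      using False by (intro max) simp
    hence "(1 / norm w)\<^sup>2 * q w \<le> q v"
      by (simp add: q_def matrix_vector_mult_scaleR power2_eq_square)
    hence "q w \<le> q v * (norm w)\<^sup>2"
      using False by (simp add: field_simps)
    thus ?thesis
      by (simp add: q_def dot_square_norm)
  qed simp
  have "B *v v = q v *\<^sub>R v"
    using \<open>v \<bullet> v = 1\<close> by (intro eigenvector_if_rayleigh_bound_attained[OF sym bound]) (simp add: q_def)
  moreover have "v \<noteq> 0"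
    using \<open>v \<bullet> v = 1\<close> by auto
  ultimately show ?thesis
    using that bound by blast
qed

lemma symmetric_eigenvectors_orthogonal:
  fixes B :: "real^'n^'n"
  assumes sym: "transpose B = B"
    and "B *v x = l1 *\<^sub>R x" "B *v y = l2 *\<^sub>R y" "l1 \<noteq> l2"
  shows "x \<bullet> y = 0"
proof -
  have "l2 * (x \<bullet> y) = x \<bullet> (B *v y)"
    using assms(3) by simp
  also have "\<dots> = (B *v x) \<bullet> y"
    by (rule symmetric_inner_mult[OF sym])
  also have "\<dots> = l1 * (x \<bullet> y)"
    using assms(2) by simp
  finally show ?thesis
    using \<open>l1 \<noteq> l2\<close> by simp
qed

lemma symmetric_eigenvalues_finite:
  fixes B :: "real^'n^'n"
  assumes sym: "transpose B = B"
  shows "finite {l. \<exists>v. v \<noteq> 0 \<and> B *v v = l *\<^sub>R v}" (is "finite ?E")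
proof (rule ccontr)
  assume "infinite ?E"
  then obtain L where L: "finite L" "card L = Suc DIM(real^'n)" "L \<subseteq> ?E"
    using infinite_arbitrarily_large by blast
  define g where "g l = (SOME v. v \<noteq> 0 \<and> B *v v = l *\<^sub>R v)" for l
  have g: "g l \<noteq> 0" "B *v g l = l *\<^sub>R g l" if "l \<in> L" for l
    using someI_ex[of "\<lambda>v. v \<noteq> 0 \<and> B *v v = l *\<^sub>R v"] that L(3) by (auto simp: g_def)
  have orth: "g l1 \<bullet> g l2 = 0" if "l1 \<in> L" "l2 \<in> L" "l1 \<noteq> l2" for l1 l2
    using symmetric_eigenvectors_orthogonal[OF sym g(2) g(2)] that by blast
  have "inj_on g L"
    using orth g(1) by (metis inj_onI inner_eq_zero_iff)
  have "pairwise orthogonal (g ` L)"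
    using orth by (auto simp: pairwise_def orthogonal_def)
  moreover have "0 \<notin> g ` L"
    using g(1) by auto
  ultimately have "independent (g ` L)"
    by (rule pairwise_orthogonal_independent)
  hence "card (g ` L) \<le> DIM(real^'n)"
    using independent_bound by blast
  thus False
    using card_image[OF \<open>inj_on g L\<close>] L(2) by simp
qed

lemma quadratic_form_le_lambda_max:
  fixes B :: "real^'n^'n"
  assumes sym: "transpose B = B"
  shows "v \<bullet> (B *v v) \<le> lambda_max B * (v \<bullet> v)"
proof -
  obtain M w where M: "w \<noteq> 0" "B *v w = M *\<^sub>R w" "\<And>v. v \<bullet> (B *v v) \<le> M * (v \<bullet> v)"
    using symmetric_max_eigenvalue[OF sym] by blast
  have "M \<le> lambda_max B"
    unfolding lambda_max_def using M(1,2) by (intro Max_ge[OF symmetric_eigenvalues_finite[OF sym]]) blast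
  thus ?thesis
    using M(3)[of v] mult_right_mono[of M "lambda_max B" "v \<bullet> v"] by simp
qed

lemma quadratic_form_le_mu:
  fixes A :: "real^'n^'n"
  shows "v \<bullet> (A *v v) \<le> mu A * (v \<bullet> v)"
proof -
  have "v \<bullet> (transpose A *v v) = v \<bullet> (A *v v)"
    by (metis dot_lmul_matrix inner_commute transpose_matrix_vector)
  hence "v \<bullet> ((A + transpose A) *v v) = 2 * (v \<bullet> (A *v v))"
    by (simp add: matrix_vector_mult_add_rdistrib inner_add_right)
  moreover have "transpose (A + transpose A) = A + transpose A"
    by (simp add: transpose_def vec_eq_iff add.commute)
  ultimately show ?thesis
    using quadratic_form_le_lambda_max[of "A + transpose A" v] by (simp add: mu_def)
qed

lemma symmetric_eq_0_if_eigenvalues_0: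
  fixes D :: "real^'n^'n"
  assumes sym: "transpose D = D"
    and eigenvalues_0: "\<And>w l. w \<noteq> 0 \<Longrightarrow> D *v w = l *\<^sub>R w \<Longrightarrow> l = 0"
  shows "D = 0"
proof -
  have form_nonpos: "w \<bullet> (D *v w) \<le> 0" for w
    using symmetric_max_eigenvalue[OF sym] eigenvalues_0 by (metis mult_zero_left)
  have neg_mult: "(- D) *v w = - (D *v w)" for w
    by (simp add: matrix_vector_mult_def vec_eq_iff sum_negf)
  have "transpose (- D) = - D"
    using sym by (simp add: transpose_def vec_eq_iff)
  moreover have "w \<noteq> 0 \<Longrightarrow> (- D) *v w = l *\<^sub>R w \<Longrightarrow> l = 0" for w l
    using eigenvalues_0[of w "- l"] by (simp add: neg_mult minus_equation_iff[of "D *v w"])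
  ultimately have "v \<bullet> ((- D) *v v) \<le> 0" for v
    using symmetric_max_eigenvalue by (metis mult_zero_left)
  hence "v \<bullet> (D *v v) = 0" for v
    using form_nonpos[of v] by (simp add: neg_mult order_antisym)
  hence "D *v v = 0 *\<^sub>R v" for v
    using form_nonpos by (intro eigenvector_if_rayleigh_bound_attained[OF sym]) simp_all
  thus ?thesis
    by (simp add: matrix_eq)
qed

section \<open>Positive definite square roots and weighted norms\<close>

lemma pos_def_sqrt_unique:
  fixes Q S :: "real^'n^'n"
  assumes Q: "pos_def Q" and S: "pos_def S" and sq: "S ** S = Q ** Q"
  shows "S = Q"
proof -
  define D where "D = S - Q"
  have sym: "transpose D = D"
    using Q S by (simp add: pos_def_def D_def transpose_def vec_eq_iff)
  have commute: "S *v (D *v w) + D *v (Q *v w) = 0" for w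
  proof -
    have "S *v (S *v w) = Q *v (Q *v w)"
      using sq by (simp add: matrix_vector_mul_assoc)
    thus ?thesis
      by (simp add: D_def matrix_vector_mult_diff_rdistrib matrix_vector_mult_diff_distrib)
  qed
  have "l = 0" if w: "w \<noteq> 0" "D *v w = l *\<^sub>R w" for w l
  proof -
    have "0 = w \<bullet> (S *v (D *v w)) + w \<bullet> (D *v (Q *v w))"
      using commute[of w] by (simp flip: inner_add_right)
    also have "\<dots> = w \<bullet> (S *v (D *v w)) + (D *v w) \<bullet> (Q *v w)"
      by (simp add: symmetric_inner_mult[OF sym])
    also have "\<dots> = l * (w \<bullet> (S *v w) + w \<bullet> (Q *v w))"
      unfolding w(2) by (simp add: matrix_vector_mult_scaleR distrib_left)
    finally show ?thesis
      using S Q w(1) unfolding pos_def_def by (metis add_pos_pos mult_eq_0_iff order_less_irrefl)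
  qed
  hence "D = 0"
    by (rule symmetric_eq_0_if_eigenvalues_0[OF sym])
  thus ?thesis
    by (simp add: D_def)
qed

lemma mat_sqrt_transpose_mult:
  fixes Q :: "real^'n^'n"
  assumes Q: "pos_def Q"
  shows "mat_sqrt (transpose Q ** Q) = Q"
  unfolding mat_sqrt_def
proof (rule the_equality)
  have "transpose Q = Q"
    using Q by (simp add: pos_def_def)
  thus "pos_def Q \<and> Q ** Q = transpose Q ** Q"
    using Q by simp
  fix S assume "pos_def S \<and> S ** S = transpose Q ** Q"
  thus "S = Q"
    using pos_def_sqrt_unique[OF Q] \<open>transpose Q = Q\<close> by simp
qed

lemma pos_def_matrix_inv_left:
  fixes Q :: "real^'n^'n"
  assumes "pos_def Q"
  shows "matrix_inv Q ** Q = mat 1"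
proof -
  have "\<forall>x. Q *v x = 0 \<longrightarrow> x = 0"
    using assms unfolding pos_def_def by (metis inner_zero_right less_irrefl)
  hence "invertible Q"
    by (simp add: invertible_left_inverse matrix_left_invertible_ker)
  hence "\<exists>Q'. Q ** Q' = mat 1 \<and> Q' ** Q = mat 1"
    by (simp add: invertible_def)
  thus ?thesis
    unfolding matrix_inv_def by (rule someI2_ex) simp
qed

lemma vnormO_transpose_mult: "vnormO (transpose Q ** Q) y = norm (Q *v y)"
proof -
  have "y \<bullet> ((transpose Q ** Q) *v y) = (Q *v y) \<bullet> (Q *v y)"
    by (metis dot_lmul_matrix inner_commute matrix_vector_mul_assoc transpose_matrix_vector)
  thus ?thesis
    by (simp add: vnormO_def norm_eq_sqrt_inner)
qed

section \<open>Kronecker products and the shifted quadratic field\<close>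

lemma sum_UNIV_prod:
  "(\<Sum>p\<in>(UNIV :: ('a::finite \<times> 'b::finite) set). f (fst p) (snd p)) = (\<Sum>i\<in>UNIV. \<Sum>j\<in>UNIV. f i j)"
  by (subst sum.cartesian_product) (simp add: case_prod_beta)

lemma kron_vec_id_mult: "kron_vec_id s *v u = vkron s u"
  by (simp add: kron_vec_id_def vkron_def matrix_vector_mult_def mat_def vec_eq_iff
      if_distrib if_distribR sum.delta cong del: if_weak_cong)

lemma kron_id_vec_mult: "kron_id_vec s *v u = vkron u s"
  by (simp add: kron_id_vec_def vkron_def matrix_vector_mult_def mat_def vec_eq_iff
      if_distrib if_distribR sum.delta mult.commute cong del: if_weak_cong)

lemma vkron_add: "vkron (x + y) (x + y) = vkron x x + vkron y x + vkron x y + vkron y y"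
  by (simp add: vkron_def vec_eq_iff algebra_simps)

lemma mkron_vkron: "mkron A B *v vkron x y = vkron (A *v x) (B *v y)"
proof -
  have "(mkron A B *v vkron x y) $ p
      = (\<Sum>i\<in>UNIV. \<Sum>j\<in>UNIV. (A $ fst p $ i * x $ i) * (B $ snd p $ j * y $ j))" for p
    by (simp add: mkron_def vkron_def matrix_vector_mult_def algebra_simps flip: sum_UNIV_prod)
  thus ?thesis
    by (simp add: vec_eq_iff vkron_def matrix_vector_mult_def sum_product)
qed

lemma mkron_mult: "mkron A B ** mkron C D = mkron (A ** C) (B ** D)"
proof -
  have "(mkron A B ** mkron C D) $ p $ q
      = (\<Sum>i\<in>UNIV. \<Sum>j\<in>UNIV. (A $ fst p $ i * C $ i $ fst q) * (B $ snd p $ j * D $ j $ snd q))"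
    for p q
    by (simp add: mkron_def matrix_matrix_mult_def algebra_simps flip: sum_UNIV_prod)
  thus ?thesis
    by (simp add: vec_eq_iff mkron_def matrix_matrix_mult_def sum_product)
qed

lemma mkron_mat_1: "mkron (mat 1) (mat 1) = mat 1"
  by (auto simp: mkron_def mat_def vec_eq_iff prod_eq_iff)

lemma norm_vkron: "norm (vkron x y) = norm x * norm y"
proof -
  have "vkron x y \<bullet> vkron x y = (\<Sum>i\<in>UNIV. \<Sum>j\<in>UNIV. (x $ i * x $ i) * (y $ j * y $ j))"
    by (simp add: inner_vec_def vkron_def algebra_simps flip: sum_UNIV_prod)
  also have "\<dots> = (x \<bullet> x) * (y \<bullet> y)"
    by (simp add: sum_product inner_vec_def)
  finally show ?thesis
    by (simp add: norm_eq_sqrt_inner real_sqrt_mult)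
qed

lemma quadratic_field_shift:
  "F2 *v vkron (u + s) (u + s) + F1 *v (u + s) + F0
     = F2 *v vkron u u + F1s F2 F1 s *v u + F0s F2 F1 F0 s"
  by (simp add: vkron_add F1s_def F0s_def matrix_vector_mult_add_rdistrib matrix_vector_right_distrib
      matrix_vector_mul_assoc[symmetric] kron_vec_id_mult kron_id_vec_mult algebra_simps)

lemma quadratic_field_conj:
  assumes "Qi ** Q = mat 1"
  shows "Q *v (F2 *v vkron u u + F1 *v u + F0)
     = (Q ** F2 ** mkron Qi Qi) *v vkron (Q *v u) (Q *v u) + (Q ** F1 ** Qi) *v (Q *v u) + Q *v F0"
proof -
  have "Qi *v (Q *v u) = u"
    by (simp add: assms matrix_vector_mul_assoc)
  thus ?thesis
    by (simp add: matrix_vector_mul_assoc[symmetric] mkron_vkron matrix_vector_right_distrib)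
qed

lemma inner_quadratic_field_le:
  fixes G :: "real^('n \<times> 'n)^'n" and A :: "real^'n^'n"
  shows "v \<bullet> (G *v vkron v v + A *v v + w)
     \<le> norm v * (onorm ((*v) G) * (norm v)\<^sup>2 + mu A * norm v + norm w)"
proof -
  have "v \<bullet> (G *v vkron v v) \<le> norm v * (onorm ((*v) G) * norm (vkron v v))"
    using norm_cauchy_schwarz onorm[OF matrix_vector_mul_bounded_linear, of G]
    by (meson mult_left_mono norm_ge_zero order_trans)
  moreover have "v \<bullet> (A *v v) \<le> mu A * (norm v)\<^sup>2"
    using quadratic_form_le_mu[of v A] by (simp add: dot_square_norm)
  moreover have "v \<bullet> w \<le> norm v * norm w"
    by (rule norm_cauchy_schwarz)
  ultimately show ?thesis
    by (simp add: inner_add_right norm_vkron power2_eq_square algebra_simps)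
qed

section \<open>Barriers for scalar differential inequalities\<close>

lemma le_if_derivative_nonpos:
  fixes f f' :: "real \<Rightarrow> real"
  assumes "t0 < t1" and sub: "{t0..t1} \<subseteq> J"
    and der: "\<And>t. t \<in> J \<Longrightarrow> (f has_real_derivative f' t) (at t within J)"
    and nonpos: "\<And>t. t0 < t \<Longrightarrow> t < t1 \<Longrightarrow> f' t \<le> 0"
  shows "f t1 \<le> f t0"
proof -
  have "\<exists>z\<in>{t0<..<t1}. f t1 - f t0 = f' z * (t1 - t0)"
  proof (rule mvt_simple[OF \<open>t0 < t1\<close>])
    fix z assume "t0 \<le> z" "z \<le> t1"
    thus "(f has_derivative (*) (f' z)) (at z within {t0..t1})"
      using has_field_derivative_subset[OF der sub] sub by (auto simp: has_field_derivative_def)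
  qed
  then obtain z where "t0 < z" "z < t1" "f t1 - f t0 = f' z * (t1 - t0)"
    by auto
  thus ?thesis
    using nonpos[of z] mult_nonpos_nonneg[of "f' z" "t1 - t0"] by simp
qed

lemma last_time_le:
  fixes f :: "real \<Rightarrow> real"
  assumes cont: "continuous_on {a..b} f" and "a \<le> b" and "f a \<le> c"
  obtains t0 where "t0 \<in> {a..b}" "f t0 \<le> c" "\<And>t. t0 < t \<Longrightarrow> t \<le> b \<Longrightarrow> c < f t"
proof -
  define S where "S = {a..b} \<inter> f -` {..c}"
  have "closed S"
    unfolding S_def by (rule continuous_closed_preimage[OF cont]) auto
  moreover have "a \<in> S" "bdd_above S"
    using assms by (auto simp: S_def intro: bdd_aboveI[of _ b])
  ultimately have "Sup S \<in> S"
    using closed_contains_Sup by blast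
  moreover have "c < f t" if "Sup S < t" "t \<le> b" for t
    using that cSup_upper[OF _ \<open>bdd_above S\<close>, of t] \<open>a \<in> S\<close> \<open>Sup S \<in> S\<close>
    by (force simp: S_def)
  ultimately show ?thesis
    using that by (auto simp: S_def)
qed

lemma derivative_barrier_le:
  fixes f f' :: "real \<Rightarrow> real"
  assumes J: "is_interval J" "0 \<in> J"
    and der: "\<And>t. t \<in> J \<Longrightarrow> (f has_real_derivative f' t) (at t within J)"
    and "f 0 \<le> b" and "\<epsilon> > 0"
    and nonpos: "\<And>t. t \<in> J \<Longrightarrow> t \<ge> 0 \<Longrightarrow> b < f t \<Longrightarrow> f t < b + \<epsilon> \<Longrightarrow> f' t \<le> 0"
    and t1: "t1 \<in> J" "t1 \<ge> 0"
  shows "f t1 \<le> b"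
proof (rule ccontr)
  assume "\<not> f t1 \<le> b"
  define c where "c = (b + min (f t1) (b + \<epsilon>)) / 2"
  have c: "b < c" "c < f t1" "c < b + \<epsilon>"
    using \<open>\<not> f t1 \<le> b\<close> \<open>\<epsilon> > 0\<close> by (auto simp: c_def)
  have sub: "{0..t1} \<subseteq> J"
    using J t1 unfolding is_interval_1 by (metis atLeastAtMost_iff subsetI)
  have cont: "continuous_on J f"
    using der DERIV_continuous continuous_on_eq_continuous_within by blast
  have "f 0 \<le> c"
    using \<open>f 0 \<le> b\<close> c by linarith
  obtain t0 where t0: "t0 \<in> {0..t1}" "f t0 \<le> c" and above: "\<And>t. t0 < t \<Longrightarrow> t \<le> t1 \<Longrightarrow> c < f t"
    using last_time_le[OF continuous_on_subset[OF cont sub] t1(2) \<open>f 0 \<le> c\<close>] by blast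
  have "t0 < t1"
    using t0 c by (cases "t0 = t1") auto
  have "t0 \<in> J"
    using sub t0 by auto
  have "(f \<longlongrightarrow> f t0) (at t0 within J)"
    using DERIV_continuous[OF der[OF \<open>t0 \<in> J\<close>]] by (simp add: continuous_within)
  hence "\<forall>\<^sub>F t in at t0 within J. f t < b + \<epsilon>"
    using t0 c by (intro order_tendstoD(2)[of f "f t0"]) auto
  then obtain d where "d > 0" and below: "\<And>t. t \<in> J \<Longrightarrow> t \<noteq> t0 \<Longrightarrow> dist t t0 < d \<Longrightarrow> f t < b + \<epsilon>"
    by (auto simp: eventually_at)
  define t' where "t' = min t1 (t0 + d / 2)"
  have t': "t0 < t'" "t' \<le> t1" "t' < t0 + d"
    using \<open>d > 0\<close> \<open>t0 < t1\<close> by (auto simp: t'_def)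
  have "f t' \<le> f t0"
  proof (rule le_if_derivative_nonpos[OF t'(1) _ der])
    show "{t0..t'} \<subseteq> J"
      using sub t0 t' by auto
    fix z assume "t0 < z" "z < t'"
    moreover from this have "z \<in> J"
      using sub t0 t' by auto
    ultimately show "f' z \<le> 0"
      using nonpos above[of z] below[of z] t' t0 c by (auto simp: dist_real_def)
  qed
  thus False
    using above[of t'] t' t0 by simp
qed

lemma derivative_barrier_less:
  fixes f f' :: "real \<Rightarrow> real"
  assumes J: "is_interval J" "0 \<in> J"
    and der: "\<And>t. t \<in> J \<Longrightarrow> (f has_real_derivative f' t) (at t within J)"
    and "f 0 < b"
    and growth: "\<And>t. t \<in> J \<Longrightarrow> t \<ge> 0 \<Longrightarrow> f t < b \<Longrightarrow> f' t \<le> K * (b - f t)"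
    and t1: "t1 \<in> J" "t1 \<ge> 0"
  shows "f t1 < b"
proof -
  define g where "g t = (f t - b) * exp (K * t)" for t
  have g_neg: "g t < 0 \<longleftrightarrow> f t < b" for t
    by (simp add: g_def mult_less_0_iff)
  have der_g: "(g has_real_derivative (f' t - K * (b - f t)) * exp (K * t)) (at t within J)"
    if "t \<in> J" for t
    unfolding g_def
    by (auto intro!: derivative_eq_intros der[OF that] simp: algebra_simps)
  have "g t1 \<le> g 0"
  proof (rule derivative_barrier_le[OF J der_g order_refl _ _ t1])
    show "- g 0 > 0"
      using \<open>f 0 < b\<close> g_neg[of 0] by simp
    fix t assume "t \<in> J" "t \<ge> 0" "g 0 < g t" "g t < g 0 + - g 0"
    thus "(f' t - K * (b - f t)) * exp (K * t) \<le> 0"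
      using growth g_neg[of t] by (simp add: mult_nonpos_nonneg)
  qed
  thus ?thesis
    using \<open>f 0 < b\<close> g_neg[of 0] g_neg[of t1] by linarith
qed

lemma quadratic_roots:
  fixes a m c r1 r2 :: real
  assumes "a > 0" "m < 0" "c \<ge> 0" "m\<^sup>2 - 4 * a * c > 0"
    and r1: "r1 = (- m - sqrt (m\<^sup>2 - 4 * a * c)) / (2 * a)"
    and r2: "r2 = (- m + sqrt (m\<^sup>2 - 4 * a * c)) / (2 * a)"
  shows "0 \<le> r1" "r1 < r2" "a * r\<^sup>2 + m * r + c = a * (r - r1) * (r - r2)"
proof -
  define d where "d = sqrt (m\<^sup>2 - 4 * a * c)"
  have "0 < d" "d\<^sup>2 = m\<^sup>2 - 4 * a * c"
    using assms(4) by (auto simp: d_def)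
  have r1_d: "r1 = (- m - d) / (2 * a)" and r2_d: "r2 = (- m + d) / (2 * a)"
    by (simp_all add: r1 r2 d_def)
  have "d \<le> sqrt (m\<^sup>2)"
    unfolding d_def using assms(1,3) by (intro real_sqrt_le_mono) simp
  hence "d \<le> - m"
    using \<open>m < 0\<close> by simp
  show "0 \<le> r1" "r1 < r2"
    using \<open>a > 0\<close> \<open>0 < d\<close> \<open>d \<le> - m\<close> by (auto simp: r1_d r2_d divide_strict_right_mono)
  have "4 * a * (a * (r - r1) * (r - r2)) = 4 * a * (a * r\<^sup>2 + m * r) + (m\<^sup>2 - d\<^sup>2)"
    using \<open>a > 0\<close> by (simp add: r1_d r2_d field_simps power2_eq_square)
  also have "\<dots> = 4 * a * (a * r\<^sup>2 + m * r + c)"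
    using \<open>d\<^sup>2 = m\<^sup>2 - 4 * a * c\<close> by (simp add: algebra_simps)
  finally show "a * r\<^sup>2 + m * r + c = a * (r - r1) * (r - r2)"
    using \<open>a > 0\<close> by simp
qed

lemma radius_nonincreasing_between_roots:
  fixes n N' :: "real \<Rightarrow> real"
  assumes J: "is_interval J" "0 \<in> J"
    and der: "\<And>t. t \<in> J \<Longrightarrow> ((\<lambda>t. (n t)\<^sup>2) has_real_derivative N' t) (at t within J)"
    and nonneg: "\<And>t. n t \<ge> 0"
    and bound: "\<And>t. t \<in> J \<Longrightarrow> N' t \<le> 2 * a * n t * (n t - r1) * (n t - r2)"
    and "a > 0" "r1 \<le> n 0" "n 0 < r2"
    and t: "t \<in> J" "t \<ge> 0"
  shows "n t \<le> n 0"
proof -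
  have "(n t)\<^sup>2 \<le> (n 0)\<^sup>2"
  proof (rule derivative_barrier_le[OF J der order_refl _ _ t])
    show "r2\<^sup>2 - (n 0)\<^sup>2 > 0"
      using nonneg[of 0] \<open>n 0 < r2\<close> by (simp add: power_strict_mono)
    fix s assume "s \<in> J" "(n 0)\<^sup>2 < (n s)\<^sup>2" "(n s)\<^sup>2 < (n 0)\<^sup>2 + (r2\<^sup>2 - (n 0)\<^sup>2)"
    moreover have "r2 \<ge> 0"
      using nonneg[of 0] \<open>n 0 < r2\<close> by linarith
    ultimately have "n 0 < n s" "n s < r2"
      using nonneg[of s] power_less_imp_less_base by auto
    hence "2 * a * n s * (n s - r1) * (n s - r2) < 0"
      using \<open>a > 0\<close> \<open>r1 \<le> n 0\<close> nonneg[of 0]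
      by (intro mult_pos_neg mult_pos_pos) auto
    thus "N' s \<le> 0"
      using bound[OF \<open>s \<in> J\<close>] by linarith
  qed
  thus ?thesis
    using nonneg[of 0] by (rule power2_le_imp_le)
qed

lemma radius_below_smaller_root:
  fixes n N' :: "real \<Rightarrow> real"
  assumes J: "is_interval J" "0 \<in> J"
    and der: "\<And>t. t \<in> J \<Longrightarrow> ((\<lambda>t. (n t)\<^sup>2) has_real_derivative N' t) (at t within J)"
    and nonneg: "\<And>t. n t \<ge> 0"
    and bound: "\<And>t. t \<in> J \<Longrightarrow> N' t \<le> 2 * a * n t * (n t - r1) * (n t - r2)"
    and "a > 0" "0 \<le> r1" "r1 \<le> r2" "n 0 < r1"
    and t: "t \<in> J" "t \<ge> 0"
  shows "n t < r1"
proof -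
  have "(n t)\<^sup>2 < r1\<^sup>2"
  proof (rule derivative_barrier_less[OF J der _ _ t])
    show "(n 0)\<^sup>2 < r1\<^sup>2"
      using nonneg[of 0] \<open>n 0 < r1\<close> by (simp add: power_strict_mono)
    fix s assume "s \<in> J" "(n s)\<^sup>2 < r1\<^sup>2"
    hence "n s < r1"
      using \<open>0 \<le> r1\<close> power_less_imp_less_base by blast
    have "2 * a * r2 * (r1\<^sup>2 - (n s)\<^sup>2) - 2 * a * n s * (n s - r1) * (n s - r2)
        = 2 * a * (r1 - n s) * (r1 * r2 + (n s)\<^sup>2)"
      by (simp add: algebra_simps power2_eq_square)
    also have "\<dots> \<ge> 0"
      using \<open>a > 0\<close> \<open>n s < r1\<close> \<open>0 \<le> r1\<close> \<open>r1 \<le> r2\<close> by (intro mult_nonneg_nonneg) auto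
    finally show "N' s \<le> 2 * a * r2 * (r1\<^sup>2 - (n s)\<^sup>2)"
      using bound[OF \<open>s \<in> J\<close>] by linarith
  qed
  thus ?thesis
    using \<open>0 \<le> r1\<close> power_less_imp_less_base by blast
qed

section \<open>The energy inequality in the weighted norm\<close>

lemma tnormO_pos:
  assumes Q: "pos_def Q" and O: "Om = transpose Q ** Q" and "F2 \<noteq> 0"
  shows "tnormO Om F2 > 0"
proof -
  define Qi where "Qi = matrix_inv Q"
  define G where "G = Q ** F2 ** mkron Qi Qi"
  have "Qi ** Q = mat 1"
    using pos_def_matrix_inv_left[OF Q] by (simp add: Qi_def)
  hence "F2 = Qi ** G ** mkron Q Q"
    by (simp add: G_def matrix_mul_assoc mkron_mult mkron_mat_1 flip: matrix_mul_assoc[of _ _ "mkron Q Q"])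
  hence "G \<noteq> 0"
    using \<open>F2 \<noteq> 0\<close> by auto
  hence "\<not> (\<forall>y. G *v y = 0)"
    by (metis matrix_eq matrix_vector_mult_0)
  thus ?thesis
    using mat_sqrt_transpose_mult[OF Q] by (simp add: O tnormO_def G_def Qi_def onorm_pos_lt)
qed

lemma inner_field_le_weighted:
  fixes F2 :: "real^('n \<times> 'n)^'n" and F1 Q Om :: "real^'n^'n" and F0 s x :: "real^'n"
  assumes Q: "pos_def Q" and O: "Om = transpose Q ** Q"
  shows "(Q *v (x - s)) \<bullet> (Q *v (F2 *v vkron x x + F1 *v x + F0))
     \<le> vnormO Om (x - s) * (tnormO Om F2 * (vnormO Om (x - s))\<^sup>2
          + muO Om (F1s F2 F1 s) * vnormO Om (x - s) + vnormO Om (F0s F2 F1 F0 s))"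
proof -
  define Qi where "Qi = matrix_inv Q"
  have "Qi ** Q = mat 1"
    using pos_def_matrix_inv_left[OF Q] by (simp add: Qi_def)
  have "mat_sqrt Om = Q"
    using mat_sqrt_transpose_mult[OF Q] O by simp
  hence "tnormO Om F2 = onorm ((*v) (Q ** F2 ** mkron Qi Qi))"
    "muO Om (F1s F2 F1 s) = mu (Q ** F1s F2 F1 s ** Qi)"
    "vnormO Om y = norm (Q *v y)" for y
    by (simp_all add: tnormO_def muO_def Qi_def O vnormO_transpose_mult)
  moreover have "F2 *v vkron x x + F1 *v x + F0
      = F2 *v vkron (x - s) (x - s) + F1s F2 F1 s *v (x - s) + F0s F2 F1 F0 s"
    using quadratic_field_shift[of F2 "x - s" s F1 F0] by simp
  ultimately show ?thesis
    using inner_quadratic_field_le[of "Q *v (x - s)" "Q ** F2 ** mkron Qi Qi" "Q ** F1s F2 F1 s ** Qi"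
        "Q *v F0s F2 F1 F0 s"]
    by (simp add: quadratic_field_conj[OF \<open>Qi ** Q = mat 1\<close>])
qed

lemma has_real_derivative_norm_mult_diff_power2:
  fixes Q :: "real^'n^'m"
  assumes "(x has_vector_derivative x') (at t within J)"
  shows "((\<lambda>t. (norm (Q *v (x t - s)))\<^sup>2) has_real_derivative 2 * ((Q *v (x t - s)) \<bullet> (Q *v x')))
      (at t within J)"
proof -
  have "((\<lambda>t. Q *v (x t - s)) has_vector_derivative Q *v x') (at t within J)"
    using assms
    by (auto intro!: derivative_eq_intros bounded_linear.has_vector_derivative[OF matrix_vector_mul_bounded_linear])
  hence "((\<lambda>t. (Q *v (x t - s)) \<bullet> (Q *v (x t - s))) has_vector_derivative
      (Q *v (x t - s)) \<bullet> (Q *v x') + (Q *v x') \<bullet> (Q *v (x t - s))) (at t within J)"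
    using bounded_bilinear.has_vector_derivative[OF bounded_bilinear_inner] by blast
  thus ?thesis
    unfolding power2_norm_eq_inner has_real_derivative_iff_has_vector_derivative
    by (simp add: inner_commute)
qed

theorem lemma5:
  fixes F2 :: "real^('n \<times> 'n)^'n" and F1 Q Om :: "real^'n^'n" and F0 s :: "real^'n"
    and x u v :: "real \<Rightarrow> real^'n" and J :: "real set" and r_plus r_minus :: real
  assumes J: "is_interval J" "0 \<in> J"
    and ode: "\<forall>t\<in>J. (x has_vector_derivative (F2 *v vkron (x t) (x t) + F1 *v x t + F0)) (at t within J)"
    and Q: "pos_def Q"
    and O_def: "Om = transpose Q ** Q"
    and u_def: "u = (\<lambda>t. x t - s)"
    and v_def: "v = (\<lambda>t. Q *v u t)"
    and F2s_nz: "F2 \<noteq> 0"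
    and mu_neg: "muO Om (F1s F2 F1 s) < 0"
    and disc: "(muO Om (F1s F2 F1 s))\<^sup>2 - 4 * tnormO Om F2 * vnormO Om (F0s F2 F1 F0 s) > 0"
    and r_plus_def: "r_plus = (- muO Om (F1s F2 F1 s) + sqrt ((muO Om (F1s F2 F1 s))\<^sup>2
                        - 4 * tnormO Om F2 * vnormO Om (F0s F2 F1 F0 s))) / (2 * tnormO Om F2)"
    and r_minus_def: "r_minus = (- muO Om (F1s F2 F1 s) - sqrt ((muO Om (F1s F2 F1 s))\<^sup>2
                        - 4 * tnormO Om F2 * vnormO Om (F0s F2 F1 F0 s))) / (2 * tnormO Om F2)"
  shows "\<forall>t\<in>J. t \<ge> 0 \<longrightarrow>
     ((r_minus \<le> vnormO Om (u 0) \<and> vnormO Om (u 0) < r_plus \<longrightarrow>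
         vnormO Om (u t) = norm (v t) \<and> norm (v t) \<le> vnormO Om (u 0) \<and> vnormO Om (u 0) < r_plus) \<and>
      (0 \<le> vnormO Om (u 0) \<and> vnormO Om (u 0) < r_minus \<longrightarrow>
         vnormO Om (u t) = norm (v t) \<and> norm (v t) < r_minus))"
proof -
  define a where "a = tnormO Om F2"
  have "a > 0"
    using tnormO_pos[OF Q O_def F2s_nz] by (simp add: a_def)
  have norm_v: "vnormO Om (u t) = norm (v t)" for t
    by (simp add: O_def v_def vnormO_transpose_mult)
  have "vnormO Om (F0s F2 F1 F0 s) \<ge> 0"
    by (simp add: O_def vnormO_transpose_mult)
  with \<open>a > 0\<close> obtain roots: "0 \<le> r_minus" "r_minus < r_plus"
    and factor: "\<And>r. a * r\<^sup>2 + muO Om (F1s F2 F1 s) * r + vnormO Om (F0s F2 F1 F0 s)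
                     = a * (r - r_minus) * (r - r_plus)"
    using quadratic_roots[of a, OF _ mu_neg _ disc[folded a_def] r_minus_def[folded a_def]
        r_plus_def[folded a_def]]
    by blast
  define x' where "x' t = F2 *v vkron (x t) (x t) + F1 *v x t + F0" for t
  have der: "((\<lambda>t. (norm (v t))\<^sup>2) has_real_derivative 2 * (v t \<bullet> (Q *v x' t))) (at t within J)"
    if "t \<in> J" for t
    using has_real_derivative_norm_mult_diff_power2[where Q = Q and s = s] ode that
    by (simp add: v_def u_def x'_def)
  have bound: "2 * (v t \<bullet> (Q *v x' t))
      \<le> 2 * a * norm (v t) * (norm (v t) - r_minus) * (norm (v t) - r_plus)" for t
  proof -
    have "v t \<bullet> (Q *v x' t) \<le> norm (v t) * (a * (norm (v t))\<^sup>2 + muO Om (F1s F2 F1 s) * norm (v t)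
        + vnormO Om (F0s F2 F1 F0 s))"
      using inner_field_le_weighted[OF Q O_def, of "x t" s F2 F1 F0]
      by (simp add: x'_def v_def u_def a_def O_def vnormO_transpose_mult)
    thus ?thesis
      unfolding factor by (simp add: mult_ac)
  qed
  show ?thesis
    using radius_nonincreasing_between_roots[OF J der _ bound \<open>a > 0\<close>]
      radius_below_smaller_root[OF J der _ bound \<open>a > 0\<close> roots(1) less_imp_le[OF roots(2)]]
    by (simp add: norm_v)
qed

end
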